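(* Let $\pi/2\leq\alpha<\pi$, let $k\geq 1$ be an integer, let $f\in\mathcal{M}(\alpha)$, and let $F_k(z)=(f(z^k))^{1/k}=z+\sum_{n=1}^{\infty}b_{kn+1}z^{kn+1}$ be the $k$-th root transform of $f$. Put $\delta_1:=\frac{1-k(1+\cos\alpha)}{2}$ and $\delta_2:=\frac{1+k(1-\cos\alpha)}{2}$. Then for every real number $\mu$, $$\left|b_{2k+1}-\mu b_{k+1}^2\right|\leq\begin{cases}\frac{1}{2k}\left(1-\cos\alpha-\frac{2\mu+k-1}{k}\right), & \text{if } \mu\leq\delta_1,\\ \frac{1}{2k}, & \text{if } \delta_1\leq\mu\leq\delta_2,\\ \frac{1}{2k}\left(\cos\alpha+\frac{2\mu+k-1}{k}-1\right), & \text{if } \mu\geq\delta_2.\end{cases}$$ The result is sharp, i.e. for each such $\alpha$, $k$ and $\mu$ equality is attained by some $f\in\mathcal{M}(\alpha)$.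
   Context: $\Delta=\{z\in\mathbb{C}:|z|<1\}$. $\mathcal{A}$ is the class of functions $f$ analytic in $\Delta$ of the form $f(z)=z+\sum_{n=2}^\infty a_nz^n$. For $\pi/2\leq\alpha<\pi$, $\mathcal{M}(\alpha)$ is the class of $f\in\mathcal{A}$ such that $$1+\frac{\alpha-\pi}{2\sin\alpha}<\mathrm{Re}\left\{\frac{zf'(z)}{f(z)}\right\}<1+\frac{\alpha}{2\sin\alpha}\quad(z\in\Delta),$$ where $zf'(z)/f(z)$ is taken to be $1$ at $z=0$. Functions in $\mathcal{M}(\alpha)$ are univalent in $\Delta$. For a univalent $f\in\mathcal{A}$ and an integer $k\geq1$, the $k$-th root transform is $F_k(z)=(f(z^k))^{1/k}=z\left(f(z^k)/z^k\right)^{1/k}$, with the analytic branch in $\Delta$ for which $(f(z^k)/z^k)^{1/k}$ equals $1$ at $z=0$. Its coefficients satisfy $b_{k+1}=\frac1k a_2$ and $b_{2k+1}=\frac1k a_3-\frac12\frac{k-1}{k^2}a_2^2$. *)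

theory Defs
  imports "HOL-Complex_Analysis.Complex_Analysis"
begin

abbreviation unit_disc :: "complex set" ("\<Delta>") where
  "\<Delta> \<equiv> ball 0 1"

text \<open>Functions are total on the complex plane, but only their values on \<open>\<Delta>\<close> matter.\<close>

definition class_A :: "(complex \<Rightarrow> complex) set" where
  "class_A = {f. f holomorphic_on \<Delta> \<and> f 0 = 0 \<and> deriv f 0 = 1}"

definition starlike_quotient :: "(complex \<Rightarrow> complex) \<Rightarrow> complex \<Rightarrow> complex" where
  "starlike_quotient f z = (if z = 0 then 1 else z * deriv f z / f z)"

text \<open>The requirement \<open>f z \<noteq> 0\<close> makes explicit that the quotient is defined on all of \<open>\<Delta>\<close>
  (division by zero would otherwise be \<open>0\<close>).\<close>

definition class_M :: "real \<Rightarrow> (complex \<Rightarrow> complex) set" where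
  "class_M \<alpha> = {f \<in> class_A.
     (\<forall>z\<in>\<Delta> - {0}. f z \<noteq> 0) \<and>
     (\<forall>z\<in>\<Delta>. 1 + (\<alpha> - pi) / (2 * sin \<alpha>) < Re (starlike_quotient f z) \<and>
            Re (starlike_quotient f z) < 1 + \<alpha> / (2 * sin \<alpha>))}"

text \<open>\<open>is_root_branch k f g\<close>: \<open>g\<close> is the analytic branch on \<open>\<Delta>\<close> of
  \<open>(f(z^k)/z^k)^(1/k)\<close> with value \<open>1\<close> at \<open>0\<close>. The values outside \<open>\<Delta>\<close> are fixed to \<open>0\<close>
  so that the branch is unique as a total function.\<close>

definition is_root_branch :: "nat \<Rightarrow> (complex \<Rightarrow> complex) \<Rightarrow> (complex \<Rightarrow> complex) \<Rightarrow> bool" where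
  "is_root_branch k f g \<longleftrightarrow>
     g holomorphic_on \<Delta> \<and> g 0 = 1 \<and>
     (\<forall>z\<in>\<Delta> - {0}. g z ^ k = f (z ^ k) / z ^ k) \<and>
     (\<forall>z. z \<notin> \<Delta> \<longrightarrow> g z = 0)"

definition root_branch :: "nat \<Rightarrow> (complex \<Rightarrow> complex) \<Rightarrow> complex \<Rightarrow> complex" where
  "root_branch k f = (THE g. is_root_branch k f g)"

definition root_transform :: "nat \<Rightarrow> (complex \<Rightarrow> complex) \<Rightarrow> complex \<Rightarrow> complex" where
  "root_transform k f z = z * root_branch k f z"

definition root_coeff :: "nat \<Rightarrow> (complex \<Rightarrow> complex) \<Rightarrow> nat \<Rightarrow> complex" where
  "root_coeff k f n = fps_nth (fps_expansion (root_transform k f) 0) n"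

text \<open>The description in \<^const>\<open>root_branch\<close> is proper. The nonvanishing hypothesis holds for
  univalent \<open>f\<close> and for \<open>f\<close> in \<^const>\<open>class_M\<close>.\<close>

lemma ex1_is_root_branch:
  assumes f: "f \<in> class_A" and nz: "\<forall>z\<in>\<Delta> - {0}. f z \<noteq> 0" and k: "k \<ge> 1"
  shows "\<exists>!g. is_root_branch k f g"
proof -
  have hf: "f holomorphic_on \<Delta>" and f0: "f 0 = 0" and f1: "deriv f 0 = 1"
    using f by (auto simp: class_A_def)
  define h where "h = (\<lambda>w. if w = 0 then deriv f 0 else (f w - f 0) / (w - 0))"
  have hh: "h holomorphic_on \<Delta>"
    unfolding h_def by (rule pole_lemma_open[OF hf]) auto
  have hnz: "h w \<noteq> 0" if "w \<in> \<Delta>" for w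
    using nz that f0 f1 by (auto simp: h_def)
  obtain L where L: "L holomorphic_on \<Delta>" "\<And>w. w \<in> \<Delta> \<Longrightarrow> exp (L w) = h w"
    using holomorphic_logarithm_exists[of \<Delta> h 0] hh hnz by (metis convex_ball open_ball centre_in_ball zero_less_one)
  have pw: "z ^ k \<in> \<Delta>" if "z \<in> \<Delta>" for z
    using that k by (auto simp: norm_power power_less_one_iff)
  define g where "g = (\<lambda>z. if z \<in> \<Delta> then exp ((L (z ^ k) - L 0) / of_nat k) else 0)"
  have h0: "h 0 = 1" by (simp add: h_def f1)
  have gk: "g z ^ k = h (z ^ k)" if "z \<in> \<Delta>" for z
  proof -
    have "g z ^ k = exp (of_nat k * ((L (z ^ k) - L 0) / of_nat k))"
      using that by (simp only: g_def if_True exp_of_nat_mult)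
    also have "\<dots> = exp (L (z ^ k) - L 0)" using k by simp
    also have "\<dots> = h (z ^ k)" using L(2)[OF pw[OF that]] L(2)[of 0] h0
      by (simp add: exp_diff)
    finally show ?thesis .
  qed
  have g: "is_root_branch k f g"
    unfolding is_root_branch_def
  proof (intro conjI ballI allI impI)
    have "(\<lambda>z. L (z ^ k)) holomorphic_on \<Delta>"
      using holomorphic_on_compose_gen[of "\<lambda>z. z ^ k" \<Delta> L \<Delta>] L(1) pw
      by (simp add: o_def image_subset_iff holomorphic_intros)
    hence "(\<lambda>z. exp ((L (z ^ k) - L 0) / of_nat k)) holomorphic_on \<Delta>"
      using k by (auto intro!: holomorphic_intros)
    thus "g holomorphic_on \<Delta>"
      by (rule holomorphic_transform) (simp add: g_def)
  next
    show "g 0 = 1" using k by (simp add: g_def power_0_left)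
  next
    fix z assume "z \<in> \<Delta> - {0}"
    thus "g z ^ k = f (z ^ k) / z ^ k"
      using gk[of z] f0 by (simp add: h_def)
  next
    fix z assume "z \<notin> \<Delta>"
    thus "g z = 0" unfolding g_def by simp
  qed
  moreover have "g' = g" if g': "is_root_branch k f g'" for g'
  proof
    fix z
    have g'k: "g' z ^ k = g z ^ k" if "z \<in> \<Delta>" for z
      using g g' that by (cases "z = 0") (auto simp: is_root_branch_def)
    have gnz: "g z \<noteq> 0" if "z \<in> \<Delta>" for z
      using that by (simp add: g_def)
    define q where "q = (\<lambda>z. g' z / g z)"
    have "q constant_on \<Delta>"
    proof (rule continuous_finite_range_constant)
      show "continuous_on \<Delta> q"
        using g g' gnz unfolding q_def is_root_branch_def
        by (intro holomorphic_on_imp_continuous_on holomorphic_on_divide) auto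
      have "q ` \<Delta> \<subseteq> {w. w ^ k = 1}"
        using g'k gnz by (auto simp: q_def power_divide)
      thus "finite (q ` \<Delta>)"
        using finite_roots_unity[OF k] finite_subset by blast
    qed auto
    moreover have "q 0 = 1"
      using g g' by (simp add: q_def is_root_branch_def)
    ultimately have "q z = 1" if "z \<in> \<Delta>" for z
      using that by (metis centre_in_ball constant_on_def zero_less_one)
    thus "g' z = g z"
      using g g' gnz by (cases "z \<in> \<Delta>") (auto simp: q_def is_root_branch_def)
  qed
  ultimately show ?thesis by blast
qed

end

theory Submission
  imports Defs
begin

text \<open>
  On the disc write \<open>f z = z exp (L z)\<close> with \<open>L 0 = 0\<close>. Then \<open>z f'(z) / f z - 1 = z L'(z) =: q z\<close>, and
  the \<open>k\<close>-th root transform is \<open>z exp (L (z^k) / k)\<close>, so that its coefficients of index \<open>k + 1\<close> and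
  \<open>2 k + 1\<close> are \<open>q\<^sub>1 / k\<close> and \<open>q\<^sub>2 / (2 k) + q\<^sub>1\<^sup>2 / (2 k\<^sup>2)\<close> in terms of the Taylor coefficients of \<open>q\<close>
  (\<open>root_coeffs_log_form\<close>).

  Membership in the class says that \<open>q\<close> takes its values in a vertical strip. The map
  \<open>q \<mapsto> E = exp (2 i sin \<alpha> q)\<close> sends that strip to the half plane \<open>Im (E exp (-i\<alpha>)) < 0\<close>, and
  \<open>E \<mapsto> (E - 1) / (exp (i\<alpha>) - E exp (-i\<alpha>))\<close> sends this half plane to the unit disc. Hence, up to
  a period of \<open>E\<close>, the value \<open>q\<close> lies in the strip if and only if the solution \<open>w\<close> of
  \<open>E (1 + w exp (-i\<alpha>)) = 1 + w exp (i\<alpha>)\<close> lies in the disc (\<open>strip_disc_iff\<close>), and the class corresponds to the functions \<open>w\<close> of the Schwarz lemma. Comparing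
  coefficients in that equation gives \<open>q\<^sub>1 = w\<^sub>1\<close> and \<open>q\<^sub>2 = w\<^sub>2 - cos \<alpha> w\<^sub>1\<^sup>2\<close>
  (\<open>subordination_coeffs\<close>), so the functional to be estimated is \<open>(w\<^sub>2 + t w\<^sub>1\<^sup>2) / (2 k)\<close> with
  \<open>t = 1 - cos \<alpha> - (2 \<mu> + k - 1) / k\<close> (\<open>Fekete_Szego_functional\<close>).

  The Schwarz--Pick inequality \<open>|w\<^sub>2| \<le> 1 - |w\<^sub>1|\<^sup>2\<close> bounds \<open>|w\<^sub>2 + t w\<^sub>1\<^sup>2|\<close> by \<open>max 1 |t|\<close>, and this value
  is attained by \<open>w z = z\<close> when \<open>|t| \<ge> 1\<close> and by \<open>w z = z\<^sup>2\<close> when \<open>|t| \<le> 1\<close>. The three cases of the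
  theorem are \<open>t \<ge> 1\<close>, \<open>-1 \<le> t \<le> 1\<close> and \<open>t \<le> -1\<close>.
\<close>

section \<open>Taylor coefficients\<close>

lemma fps_expansion_eq_of_eventually_eq:
  fixes f g :: "complex \<Rightarrow> complex"
  assumes "f has_fps_expansion F" "g has_fps_expansion G" "\<forall>\<^sub>F z in nhds 0. f z = g z"
  shows "F = G"
  using assms(1,2) has_fps_expansion_cong[OF assms(3) refl, of F]
  by (blast intro: fps_expansion_unique_complex)

text \<open>This is the Schwarz--Pick inequality at the origin for \<open>h z = w z / z\<close>, whose first two Taylor
  coefficients are those of \<open>w\<close> of index 1 and 2: the Schwarz lemma is applied to \<open>h\<close> followed by the
  disc automorphism that moves \<open>h 0\<close> to the origin. That composition is unavailable when \<open>|h|\<close> attains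
  the value 1, but then \<open>w\<close> is a rotation and its second coefficient vanishes.\<close>
lemma Schwarz_second_coeff:
  assumes hol: "w holomorphic_on \<Delta>" and w0: "w 0 = 0"
    and lt1: "\<And>z. norm z < 1 \<Longrightarrow> norm (w z) < 1"
    and W: "w has_fps_expansion W"
  shows "norm (fps_nth W 2) \<le> 1 - (norm (fps_nth W 1))\<^sup>2"
proof -
  obtain h where h: "h holomorphic_on \<Delta>" and wh: "\<And>z. norm z < 1 \<Longrightarrow> w z = z * h z"
    and d0: "deriv w 0 = h 0"
    using Schwarz3[OF hol w0] by auto
  have "h has_fps_expansion fps_expansion h 0"
    using h by (intro has_fps_expansion_fps_expansion[of \<Delta>]) auto
  hence "(\<lambda>z. z * h z) has_fps_expansion fps_X * fps_expansion h 0"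
    by (intro fps_expansion_intros)
  moreover have "\<forall>\<^sub>F z in nhds 0. z * h z = w z"
    by (rule eventually_mono[OF eventually_nhds_in_open[of \<Delta>]]) (auto simp: wh)
  ultimately have "fps_X * fps_expansion h 0 = W"
    using W by (intro fps_expansion_eq_of_eventually_eq)
  hence W1: "fps_nth W 1 = h 0" and W2: "fps_nth W 2 = deriv h 0"
    by (auto simp: fps_expansion_def)
  \<comment> \<open>In the equality case of the Schwarz lemma \<open>|h|\<close> reaches 1; otherwise \<open>h\<close> maps into the open disc.\<close>
  show ?thesis
  proof (cases "(\<exists>z. norm z < 1 \<and> z \<noteq> 0 \<and> norm (w z) = norm z) \<or> norm (deriv w 0) = 1")
    case True
    then obtain a where a: "\<And>z. norm z < 1 \<Longrightarrow> w z = a * z" "norm a = 1"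
      using Schwarz_Lemma(3)[OF hol w0 lt1, of 0] by auto
    have "(\<lambda>z. a * z) has_fps_expansion fps_const a * fps_X"
      by (intro fps_expansion_intros)
    moreover have "\<forall>\<^sub>F z in nhds 0. a * z = w z"
      by (rule eventually_mono[OF eventually_nhds_in_open[of \<Delta>]]) (auto simp: a)
    ultimately have "fps_const a * fps_X = W"
      using W by (intro fps_expansion_eq_of_eventually_eq)
    thus ?thesis using a(2) by (auto simp: fps_X_def)
  next
    case False
    have hlt: "norm (h z) < 1" if "norm z < 1" for z
    proof (cases "z = 0")
      case True
      thus ?thesis using False Schwarz_Lemma(2)[OF hol w0 lt1, of 0] d0 by auto
    next
      case nz: False
      hence "norm z * norm (h z) < norm z"
        using Schwarz_Lemma(1)[OF hol w0 lt1 that] False that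
        by (metis norm_mult order_less_le wh)
      thus ?thesis using nz by simp
    qed
    define G where "G = (\<lambda>z. Moebius_function 0 (h 0) (h z))"
    have h0: "norm (h 0) < 1" by (simp add: hlt)
    have Ghol: "G holomorphic_on \<Delta>"
      unfolding G_def
      using holomorphic_on_compose_gen[OF h Moebius_function_holomorphic[OF h0, of 0]] hlt
      by (auto simp: o_def image_subset_iff)
    have Glt: "norm (G z) < 1" if "norm z < 1" for z
      unfolding G_def by (rule Moebius_function_norm_lt_1[OF h0 hlt[OF that]])
    have G0: "G 0 = 0" by (simp add: G_def Moebius_function_eq_zero)
    have nz: "1 - cnj (h 0) * h 0 = of_real (1 - (norm (h 0))\<^sup>2)"
      by (metis (mono_tags, lifting) complex_norm_square mult.commute of_real_1 of_real_diff of_real_power)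
    have pos: "0 < 1 - (norm (h 0))\<^sup>2"
      using h0 by (simp add: power_less_one_iff abs_square_less_1)
    have nz0: "1 - cnj (h 0) * h 0 \<noteq> 0"
      unfolding nz of_real_eq_0_iff using pos by simp
    have "(h has_field_derivative deriv h 0) (at 0)"
      using h by (simp add: holomorphic_derivI[of _ \<Delta>])
    hence "(G has_field_derivative deriv h 0 / (1 - cnj (h 0) * h 0)) (at 0)"
      unfolding G_def Moebius_function_simple using nz0
      by (auto intro!: derivative_eq_intros)
    hence "deriv G 0 = deriv h 0 / (1 - cnj (h 0) * h 0)"
      by (rule DERIV_imp_deriv)
    moreover have "norm (deriv G 0) \<le> 1"
      using Schwarz_Lemma(2)[OF Ghol G0 Glt, of 0] by simp
    ultimately show ?thesis
      unfolding W1 W2 nz using pos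
      by (simp add: norm_divide del: of_real_diff)
  qed
qed

lemma exp_fps_coeffs:
  fixes f :: "complex \<Rightarrow> complex"
  assumes F: "f has_fps_expansion F" and f0: "f 0 = 0"
    and G: "(\<lambda>z. exp (f z)) has_fps_expansion G"
  shows "fps_nth G 0 = 1" "fps_nth G 1 = fps_nth F 1"
    "fps_nth G 2 = fps_nth F 2 + (fps_nth F 1)\<^sup>2 / 2"
proof -
  have F0: "fps_nth F 0 = 0"
    using has_fps_expansion_imp_0_eq_fps_nth_0[OF F] f0 by simp
  have "(exp \<circ> f) has_fps_expansion (fps_exp 1 oo F)"
    by (intro fps_expansion_intros F F0)
  hence GF: "G = fps_exp 1 oo F"
    using G fps_expansion_unique_complex by (auto simp: o_def)
  show "fps_nth G 0 = 1" "fps_nth G 1 = fps_nth F 1"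
    "fps_nth G 2 = fps_nth F 2 + (fps_nth F 1)\<^sup>2 / 2"
    by (simp_all add: GF fps_compose_nth numeral_2_eq_2 fps_mult_nth F0 field_simps)
qed

section \<open>The strip and the disc\<close>

lemma exp_strip_polar:
  "exp (2 * \<i> * of_real s * q) * cis (-\<alpha>)
    = of_real (exp (- 2 * s * Im q)) * cis (2 * s * Re q - \<alpha>)"
  by (simp add: exp_eq_polar cis_mult norm_exp_eq_Re)

text \<open>Multiplying the hypothesis by \<open>cnj v * cis (-\<alpha>)\<close>, where \<open>v = 1 + w * cis (-\<alpha>)\<close>, turns its
  right-hand side into \<open>cis (-\<alpha>) + 2 Re w + |w|\<^sup>2 cis \<alpha>\<close>. The imaginary part of this is
  \<open>sin \<alpha> (|w|\<^sup>2 - 1)\<close>, while the left-hand side becomes a positive multiple of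
  \<open>cis (2 * sin \<alpha> * Re q - \<alpha>)\<close>. Because only a sign is compared, the lemma serves both for bounding a
  given class member and for constructing extremal ones.\<close>
lemma strip_disc_iff:
  fixes q w :: complex
  assumes s: "sin \<alpha> > 0"
    and eq: "exp (2 * \<i> * of_real (sin \<alpha>) * q) * (1 + w * cis (-\<alpha>)) = 1 + w * cis \<alpha>"
  shows "norm w < 1 \<longleftrightarrow> sin (2 * sin \<alpha> * Re q - \<alpha>) < 0"
proof -
  define E where "E = exp (2 * \<i> * of_real (sin \<alpha>) * q)"
  define v where "v = 1 + w * cis (-\<alpha>)"
  have v: "v \<noteq> 0"
  proof
    assume "v = 0"
    hence "w * cis (-\<alpha>) = -1" "w * cis \<alpha> = -1"
      using eq unfolding v_def by (auto simp: add_eq_0_iff)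
    hence "w * (cis \<alpha> - cis (-\<alpha>)) = 0" "w \<noteq> 0" by (auto simp: algebra_simps)
    hence "Im (cis \<alpha>) = Im (cis (-\<alpha>))" by simp
    thus False using s by simp
  qed
  have "E * v * cnj v * cis (-\<alpha>) = (1 + w * cis \<alpha>) * (1 + cnj w * cis \<alpha>) * cis (-\<alpha>)"
    using eq by (simp add: E_def v_def cis_cnj)
  also have "\<dots> = (cis (-\<alpha>) + w * (cis \<alpha> * cis (-\<alpha>))) * (1 + cnj w * cis \<alpha>)"
    by (simp add: algebra_simps)
  also have "\<dots> = cis (-\<alpha>) + (w + cnj w * (cis \<alpha> * cis (-\<alpha>))) + w * cnj w * cis \<alpha>"
    by (simp add: algebra_simps cis_mult)
  also have "\<dots> = cis (-\<alpha>) + of_real (2 * Re w) + of_real ((norm w)\<^sup>2) * cis \<alpha>"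
    by (simp add: cis_mult complex_add_cnj complex_norm_square del: of_real_power of_real_mult)
  finally have 1: "E * v * cnj v * cis (-\<alpha>)
      = cis (-\<alpha>) + of_real (2 * Re w) + of_real ((norm w)\<^sup>2) * cis \<alpha>" .
  have "E * v * cnj v * cis (-\<alpha>) = of_real ((norm v)\<^sup>2) * (E * cis (-\<alpha>))"
    unfolding complex_norm_square by (simp add: algebra_simps)
  also have "E * cis (-\<alpha>) = of_real (exp (- 2 * sin \<alpha> * Im q)) * cis (2 * sin \<alpha> * Re q - \<alpha>)"
    unfolding E_def by (rule exp_strip_polar)
  finally have "(norm v)\<^sup>2 * (exp (- 2 * sin \<alpha> * Im q) * sin (2 * sin \<alpha> * Re q - \<alpha>))
      = Im (cis (-\<alpha>) + of_real (2 * Re w) + of_real ((norm w)\<^sup>2) * cis \<alpha>)"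
    unfolding 1 [symmetric] by (simp del: of_real_power of_real_mult)
  hence 2: "(norm v)\<^sup>2 * exp (- 2 * sin \<alpha> * Im q) * sin (2 * sin \<alpha> * Re q - \<alpha>)
      = sin \<alpha> * ((norm w)\<^sup>2 - 1)"
    by (simp add: algebra_simps del: of_real_power of_real_mult)
  have "sin (2 * sin \<alpha> * Re q - \<alpha>) < 0 \<longleftrightarrow> (norm v)\<^sup>2 * exp (- 2 * sin \<alpha> * Im q) * sin (2 * sin \<alpha> * Re q - \<alpha>) < 0"
    using v by (simp add: mult_less_0_iff)
  also have "\<dots> \<longleftrightarrow> (norm w)\<^sup>2 < 1"
    unfolding 2 using s by (simp add: mult_less_0_iff)
  finally show ?thesis by (simp add: abs_square_less_1)
qed

text \<open>The hypothesis is the equation \<open>q = B (w)\<close> for the conformal map \<open>B z = z - cos \<alpha> z\<^sup>2 + \<dots>\<close> of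
  the disc onto the strip, cleared of logarithms and denominators. In this form the coefficients
  can be read off a product of power series.\<close>
lemma subordination_coeffs:
  assumes s: "sin \<alpha> > 0" and Q: "q has_fps_expansion Q" "q 0 = 0" and W: "w has_fps_expansion W" "w 0 = 0"
    and eq: "\<forall>\<^sub>F z in nhds 0. exp (2 * \<i> * of_real (sin \<alpha>) * q z) * (1 + w z * cis (-\<alpha>)) = 1 + w z * cis \<alpha>"
  shows "fps_nth Q 1 = fps_nth W 1"
    "fps_nth Q 2 = fps_nth W 2 - cos \<alpha> * (fps_nth W 1)\<^sup>2"
proof -
  define c where "c = 2 * \<i> * complex_of_real (sin \<alpha>)"
  have cnz: "c \<noteq> 0" using s by (simp add: c_def)
  have cis: "cis \<alpha> = cis (-\<alpha>) + c" "cis (-\<alpha>) = of_real (cos \<alpha>) - c / 2"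
    by (auto simp: c_def complex_eq_iff)
  define E where "E = fps_exp 1 oo (fps_const c * Q)"
  have W0: "fps_nth W 0 = 0" using has_fps_expansion_imp_0_eq_fps_nth_0[OF W(1)] W(2) by simp
  have cQ: "(\<lambda>z. c * q z) has_fps_expansion fps_const c * Q"
    by (intro fps_expansion_intros Q)
  have "fps_nth Q 0 = 0" using has_fps_expansion_imp_0_eq_fps_nth_0[OF Q(1)] Q(2) by simp
  hence "(exp \<circ> (\<lambda>z. c * q z)) has_fps_expansion E"
    unfolding E_def by (intro fps_expansion_intros Q) simp
  hence E: "(\<lambda>z. exp (c * q z)) has_fps_expansion E" by (simp add: o_def)
  have L: "(\<lambda>z. exp (c * q z) * (1 + w z * cis (-\<alpha>))) has_fps_expansion E * (1 + W * fps_const (cis (-\<alpha>)))"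
    by (intro fps_expansion_intros E W)
  have R: "(\<lambda>z. 1 + w z * cis \<alpha>) has_fps_expansion 1 + W * fps_const (cis \<alpha>)"
    by (intro fps_expansion_intros W)
  have eq': "E * (1 + W * fps_const (cis (-\<alpha>))) = 1 + W * fps_const (cis \<alpha>)"
    using eq by (intro fps_expansion_eq_of_eventually_eq[OF L R]) (simp add: c_def)
  note Ec = exp_fps_coeffs[OF cQ _ E]
  have E0: "fps_nth E 0 = 1" and E1: "fps_nth E (Suc 0) = c * fps_nth Q 1"
    and E2: "fps_nth E (Suc (Suc 0)) = c * fps_nth Q 2 + c\<^sup>2 * (fps_nth Q 1)\<^sup>2 / 2"
    using Ec Q(2) by (simp_all add: numeral_2_eq_2 power_mult_distrib)
  have "c * fps_nth Q 1 = c * fps_nth W 1"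
    using arg_cong[OF eq', of "\<lambda>F. fps_nth F 1"]
    by (simp add: fps_mult_nth E0 E1 W0 cis(1) algebra_simps)
  thus 1: "fps_nth Q 1 = fps_nth W 1" using cnz by simp
  have "c * fps_nth Q 2 + c\<^sup>2 * (fps_nth Q 1)\<^sup>2 / 2 + c * fps_nth Q 1 * (fps_nth W 1 * cis (-\<alpha>))
      = c * fps_nth W 2"
    using arg_cong[OF eq', of "\<lambda>F. fps_nth F 2"]
    by (simp add: fps_mult_nth E0 E1 E2 W0 cis(1) algebra_simps numeral_2_eq_2)
  hence "c * (fps_nth Q 2 + c * (fps_nth W 1)\<^sup>2 / 2 + (fps_nth W 1)\<^sup>2 * cis (-\<alpha>))
      = c * fps_nth W 2"
    unfolding 1 by (simp add: power2_eq_square algebra_simps)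
  hence "fps_nth Q 2 + c * (fps_nth W 1)\<^sup>2 / 2 + (fps_nth W 1)\<^sup>2 * cis (-\<alpha>) = fps_nth W 2"
    using cnz by simp
  thus "fps_nth Q 2 = fps_nth W 2 - cos \<alpha> * (fps_nth W 1)\<^sup>2"
    unfolding cis(2) by (simp add: algebra_simps)
qed


section \<open>Logarithmic representation and root transform\<close>

lemma class_A_log_form:
  assumes f: "f \<in> class_A" and nz: "\<forall>z\<in>\<Delta> - {0}. f z \<noteq> 0"
  obtains L where "L holomorphic_on \<Delta>" "L 0 = 0" "\<And>z. z \<in> \<Delta> \<Longrightarrow> f z = z * exp (L z)"
proof -
  have hf: "f holomorphic_on \<Delta>" and f0: "f 0 = 0" and f1: "deriv f 0 = 1"
    using f by (auto simp: class_A_def)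
  obtain h where h: "h holomorphic_on \<Delta>" "\<And>z. norm z < 1 \<Longrightarrow> f z = z * h z" "deriv f 0 = h 0"
    using Schwarz3[OF hf f0] by blast
  have hnz: "h z \<noteq> 0" if "z \<in> \<Delta>" for z
    using h f1 nz that by (cases "z = 0") auto
  obtain M where M: "M holomorphic_on \<Delta>" "\<And>z. z \<in> \<Delta> \<Longrightarrow> exp (M z) = h z"
    using holomorphic_logarithm_exists[of \<Delta> h 0] h(1) hnz
    by (metis convex_ball open_ball centre_in_ball zero_less_one)
  show ?thesis
  proof (rule that[of "\<lambda>z. M z - M 0"])
    show "f z = z * exp (M z - M 0)" if "z \<in> \<Delta>" for z
      using that h M(2)[of z] M(2)[of 0] f1 by (simp add: exp_diff)
  qed (auto intro!: holomorphic_intros M)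
qed

lemma log_form_class_A:
  assumes L: "L holomorphic_on \<Delta>" "L 0 = 0" and f: "\<And>z. z \<in> \<Delta> \<Longrightarrow> f z = z * exp (L z)"
  shows "f \<in> class_A" "\<forall>z\<in>\<Delta> - {0}. f z \<noteq> 0"
    "\<And>z. z \<in> \<Delta> \<Longrightarrow> starlike_quotient f z = 1 + z * deriv L z"
proof -
  have d: "deriv f z = (1 + z * deriv L z) * exp (L z)" if z: "z \<in> \<Delta>" for z
  proof -
    have "(L has_field_derivative deriv L z) (at z)"
      using L(1) z by (simp add: holomorphic_derivI[of _ \<Delta>])
    hence "((\<lambda>z. z * exp (L z)) has_field_derivative (1 + z * deriv L z) * exp (L z)) (at z)"
      by (auto intro!: derivative_eq_intros simp: algebra_simps)
    hence "(f has_field_derivative (1 + z * deriv L z) * exp (L z)) (at z)"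
      by (rule has_field_derivative_transform_within_open[of _ _ _ \<Delta>]) (use z f in auto)
    thus ?thesis by (rule DERIV_imp_deriv)
  qed
  have "(\<lambda>z. z * exp (L z)) holomorphic_on \<Delta>"
    by (intro holomorphic_intros L)
  hence "f holomorphic_on \<Delta>"
    by (rule holomorphic_transform) (simp add: f)
  thus "f \<in> class_A"
    using d[of 0] f[of 0] L by (simp add: class_A_def)
  show "\<forall>z\<in>\<Delta> - {0}. f z \<noteq> 0" using f by simp
  show "starlike_quotient f z = 1 + z * deriv L z" if "z \<in> \<Delta>" for z
    using that by (simp add: starlike_quotient_def d f)
qed

lemma root_transform_log_form:
  assumes L: "L holomorphic_on \<Delta>" "L 0 = 0" and f: "\<And>z. z \<in> \<Delta> \<Longrightarrow> f z = z * exp (L z)"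
    and k: "k \<ge> 1" and z: "z \<in> \<Delta>"
  shows "root_transform k f z = z * exp (L (z ^ k) / of_nat k)"
proof -
  define g where "g = (\<lambda>z. if z \<in> \<Delta> then exp (L (z ^ k) / of_nat k) else 0)"
  have pw: "z ^ k \<in> \<Delta>" if "z \<in> \<Delta>" for z
    using that k by (auto simp: norm_power power_less_one_iff)
  have "is_root_branch k f g"
    unfolding is_root_branch_def
  proof (intro conjI ballI allI impI)
    have "(\<lambda>z. L (z ^ k)) holomorphic_on \<Delta>"
      using holomorphic_on_compose_gen[of "\<lambda>z. z ^ k" \<Delta> L \<Delta>] L(1) pw
      by (simp add: o_def image_subset_iff holomorphic_on_power)
    hence "(\<lambda>z. exp (L (z ^ k) / of_nat k)) holomorphic_on \<Delta>"
      using k by (auto intro!: holomorphic_intros)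
    thus "g holomorphic_on \<Delta>"
      by (rule holomorphic_transform) (simp add: g_def)
  next
    show "g 0 = 1" using k L by (simp add: g_def power_0_left)
  next
    fix z assume z: "z \<in> \<Delta> - {0}"
    hence "g z ^ k = exp (of_nat k * (L (z ^ k) / of_nat k))"
      by (simp only: g_def DiffD1 if_True exp_of_nat_mult)
    also have "\<dots> = exp (L (z ^ k))" using k by simp
    also have "\<dots> = f (z ^ k) / z ^ k" using f[OF pw[of z]] z by simp
    finally show "g z ^ k = f (z ^ k) / z ^ k" .
  qed (simp only: g_def if_False)
  moreover have "\<exists>!g. is_root_branch k f g"
    by (rule ex1_is_root_branch[OF log_form_class_A(1,2)[OF L f] k])
  ultimately have "root_branch k f = g"
    unfolding root_branch_def by (intro the1_equality)
  thus ?thesis using z by (simp add: root_transform_def g_def)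
qed

text \<open>The power series of \<open>exp (L z / k)\<close> has its coefficients of index 1 and 2 moved to \<open>k\<close> and \<open>2 k\<close> by
  the substitution \<open>z \<mapsto> z^k\<close>, and to \<open>k + 1\<close> and \<open>2 k + 1\<close> by the outer factor \<open>z\<close>.\<close>
lemma root_coeffs_log_form:
  assumes L: "L holomorphic_on \<Delta>" "L 0 = 0" and f: "\<And>z. z \<in> \<Delta> \<Longrightarrow> f z = z * exp (L z)"
    and k: "k \<ge> 1" and Q: "q has_fps_expansion Q" "\<And>z. z \<in> \<Delta> \<Longrightarrow> q z = z * deriv L z"
  shows "root_coeff k f (k + 1) = fps_nth Q 1 / of_nat k"
    "root_coeff k f (2 * k + 1) = fps_nth Q 2 / (2 * of_nat k) + (fps_nth Q 1)\<^sup>2 / (2 * (of_nat k)\<^sup>2)"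
proof -
  define F where "F = fps_expansion L 0"
  define M where "M = fps_expansion (\<lambda>z. exp (L z / of_nat k)) 0"
  have F: "L has_fps_expansion F"
    unfolding F_def using L by (intro has_fps_expansion_fps_expansion[of \<Delta>]) auto
  have FQ: "fps_X * fps_deriv F = Q"
  proof (rule fps_expansion_eq_of_eventually_eq[OF _ Q(1)])
    show "(\<lambda>z. z * deriv L z) has_fps_expansion fps_X * fps_deriv F"
      by (intro fps_expansion_intros F)
    show "\<forall>\<^sub>F z in nhds 0. z * deriv L z = q z"
      by (rule eventually_mono[OF eventually_nhds_in_open[of \<Delta>]]) (auto simp: Q)
  qed
  have F1: "fps_nth F 1 = fps_nth Q 1" and F2: "fps_nth F 2 = fps_nth Q 2 / 2"
    unfolding FQ[symmetric] by (auto simp: numeral_2_eq_2)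
  have M: "(\<lambda>z. exp (L z / of_nat k)) has_fps_expansion M"
    unfolding M_def using L k
    by (intro has_fps_expansion_fps_expansion[of \<Delta>]) (auto intro!: holomorphic_intros)
  have Fk: "(\<lambda>z. L z / of_nat k) has_fps_expansion fps_const (1 / of_nat k) * F"
    using has_fps_expansion_cmult_left[OF F, of "1 / of_nat k"] by simp
  have M1: "fps_nth M 1 = fps_nth Q 1 / of_nat k"
    and M2: "fps_nth M 2 = fps_nth Q 2 / (2 * of_nat k) + (fps_nth Q 1)\<^sup>2 / (2 * (of_nat k)\<^sup>2)"
    using exp_fps_coeffs[OF Fk _ M] L(2) F1 F2 by (simp_all add: power_divide mult.commute)
  have "((\<lambda>z. exp (L z / of_nat k)) \<circ> (\<lambda>z. z ^ k)) has_fps_expansion (M oo fps_X ^ k)"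
    using k by (intro fps_expansion_intros M) auto
  hence "(\<lambda>z. z * exp (L (z ^ k) / of_nat k)) has_fps_expansion fps_X * (M oo fps_X ^ k)"
    unfolding o_def by (intro fps_expansion_intros)
  moreover have "\<forall>\<^sub>F z in nhds 0. root_transform k f z = z * exp (L (z ^ k) / of_nat k)"
    by (rule eventually_mono[OF eventually_nhds_in_open[of \<Delta>]])
      (auto intro: root_transform_log_form[OF L f k])
  ultimately have "fps_expansion (root_transform k f) 0 = fps_X * (M oo fps_X ^ k)"
    by (intro fps_expansion_eqI) (simp add: has_fps_expansion_cong)
  thus "root_coeff k f (k + 1) = fps_nth Q 1 / of_nat k"
    "root_coeff k f (2 * k + 1) = fps_nth Q 2 / (2 * of_nat k) + (fps_nth Q 1)\<^sup>2 / (2 * (of_nat k)\<^sup>2)"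
    using k by (simp_all add: root_coeff_def fps_nth_compose_X_power M1[simplified] M2)
qed

section \<open>The functional in terms of the Schwarz function\<close>

text \<open>After the triangle inequality the bound is a convex combination of 1 and \<open>|t|\<close>, with
  weights \<open>1 - |w1|\<^sup>2\<close> and \<open>|w1|\<^sup>2\<close>.\<close>
lemma norm_Fekete_Szego_le:
  fixes w1 w2 :: complex
  assumes "norm w2 \<le> 1 - (norm w1)\<^sup>2"
  shows "norm (w2 + of_real t * w1\<^sup>2) \<le> max 1 \<bar>t\<bar>"
proof -
  have "(norm w1)\<^sup>2 \<le> 1" using assms norm_ge_zero[of w2] by linarith
  have "norm (w2 + of_real t * w1\<^sup>2) \<le> (1 - (norm w1)\<^sup>2) * 1 + (norm w1)\<^sup>2 * \<bar>t\<bar>"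
    using norm_triangle_ineq[of w2 "of_real t * w1\<^sup>2"] assms
    by (simp add: norm_mult norm_power mult.commute)
  also have "\<dots> \<le> (1 - (norm w1)\<^sup>2) * max 1 \<bar>t\<bar> + (norm w1)\<^sup>2 * max 1 \<bar>t\<bar>"
    using \<open>(norm w1)\<^sup>2 \<le> 1\<close> by (intro add_mono mult_left_mono) auto
  also have "\<dots> = max 1 \<bar>t\<bar>" by (simp add: algebra_simps)
  finally show ?thesis .
qed

lemma Fekete_Szego_functional:
  assumes L: "L holomorphic_on \<Delta>" "L 0 = 0" and f: "\<And>z. z \<in> \<Delta> \<Longrightarrow> f z = z * exp (L z)"
    and k: "k \<ge> 1" and s: "sin \<alpha> > 0"
    and w: "w has_fps_expansion W" "w 0 = 0"
    and eq: "\<And>z. z \<in> \<Delta> \<Longrightarrow> exp (2 * \<i> * of_real (sin \<alpha>) * (z * deriv L z)) * (1 + w z * cis (-\<alpha>)) = 1 + w z * cis \<alpha>"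
  shows "root_coeff k f (2 * k + 1) - of_real \<mu> * (root_coeff k f (k + 1))\<^sup>2
    = (fps_nth W 2 + of_real (1 - cos \<alpha> - (2 * \<mu> + real k - 1) / real k) * (fps_nth W 1)\<^sup>2) / of_nat (2 * k)"
proof -
  have "L has_fps_expansion fps_expansion L 0"
    using L by (intro has_fps_expansion_fps_expansion[of \<Delta>]) auto
  hence "(\<lambda>z. z * deriv L z) has_fps_expansion fps_X * fps_deriv (fps_expansion L 0)"
    by (intro fps_expansion_intros)
  then obtain Q where Q: "(\<lambda>z. z * deriv L z) has_fps_expansion Q" (is "?q has_fps_expansion _")
    by blast
  have "\<forall>\<^sub>F z in nhds 0. exp (2 * \<i> * of_real (sin \<alpha>) * ?q z) * (1 + w z * cis (-\<alpha>)) = 1 + w z * cis \<alpha>"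
    by (rule eventually_mono[OF eventually_nhds_in_open[of \<Delta>]]) (auto simp: eq)
  note c = subordination_coeffs[OF s Q _ w this]
  have "root_coeff k f (k + 1) = fps_nth W 1 / of_nat k"
    using root_coeffs_log_form(1)[OF L f k Q refl] c by simp
  moreover have "root_coeff k f (2 * k + 1)
      = (fps_nth W 2 - cos \<alpha> * (fps_nth W 1)\<^sup>2) / (2 * of_nat k) + (fps_nth W 1)\<^sup>2 / (2 * (of_nat k)\<^sup>2)"
    using root_coeffs_log_form(2)[OF L f k Q refl] c by simp
  ultimately show ?thesis
    using k by (simp only:) (simp add: field_simps power2_eq_square)
qed

section \<open>Passing between the class and Schwarz functions\<close>

lemma strip_iff:
  assumes s: "sin \<alpha> > 0"
  shows "1 + (\<alpha> - pi) / (2 * sin \<alpha>) < Re (1 + q) \<and> Re (1 + q) < 1 + \<alpha> / (2 * sin \<alpha>) \<longleftrightarrow>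
    - pi < 2 * sin \<alpha> * Re q - \<alpha> \<and> 2 * sin \<alpha> * Re q - \<alpha> < 0"
  using s by (auto simp: field_simps)

lemma sin_neg_iff:
  assumes "-2 * pi < x" "x < pi"
  shows "sin x < 0 \<longleftrightarrow> - pi < x \<and> x < 0"
proof (cases "x < 0")
  case True
  show ?thesis
  proof (cases "- pi < x")
    case t: True
    thus ?thesis using True sin_gt_zero[of "-x"] by simp
  next
    case False
    hence "sin (- x) \<le> 0" using assms by (intro sin_le_zero) auto
    thus ?thesis using False by simp
  qed
next
  case False
  thus ?thesis using sin_ge_zero[of x] assms by simp
qed

text \<open>The equation is linear in \<open>w\<close>, and its solution is a quotient with denominator
  \<open>cis \<alpha> - E * cis (-\<alpha>)\<close>. The strip condition keeps this away from 0: it makes the imaginary part of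
  \<open>E * cis (-\<alpha>)\<close> negative, while that of \<open>cis \<alpha>\<close> is positive.\<close>
lemma class_M_subordinate:
  assumes s: "sin \<alpha> > 0"
    and L: "L holomorphic_on \<Delta>" and strip: "\<And>z. z \<in> \<Delta> \<Longrightarrow>
      1 + (\<alpha> - pi) / (2 * sin \<alpha>) < Re (1 + z * deriv L z) \<and> Re (1 + z * deriv L z) < 1 + \<alpha> / (2 * sin \<alpha>)"
  obtains w where "w holomorphic_on \<Delta>" "w 0 = 0" "\<And>z. norm z < 1 \<Longrightarrow> norm (w z) < 1"
    "\<And>z. z \<in> \<Delta> \<Longrightarrow> exp (2 * \<i> * of_real (sin \<alpha>) * (z * deriv L z)) * (1 + w z * cis (-\<alpha>)) = 1 + w z * cis \<alpha>"
proof -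
  define E where "E = (\<lambda>z. exp (2 * \<i> * of_real (sin \<alpha>) * (z * deriv L z)))"
  define w where "w = (\<lambda>z. (E z - 1) / (cis \<alpha> - E z * cis (-\<alpha>)))"
  have sneg: "sin (2 * sin \<alpha> * Re (z * deriv L z) - \<alpha>) < 0" if "z \<in> \<Delta>" for z
    using strip[OF that] sin_gt_zero[of "- (2 * sin \<alpha> * Re (z * deriv L z) - \<alpha>)"]
    unfolding strip_iff[OF s] sin_minus by linarith
  have Im_mult_real: "Im (of_real r * u) = r * Im u" for r u by simp
  have nz: "cis \<alpha> - E z * cis (-\<alpha>) \<noteq> 0" if "z \<in> \<Delta>" for z
  proof
    assume "cis \<alpha> - E z * cis (-\<alpha>) = 0"
    hence "Im (cis \<alpha>) = Im (E z * cis (-\<alpha>))" by simp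
    also have "E z * cis (-\<alpha>) = of_real (exp (- 2 * sin \<alpha> * Im (z * deriv L z)))
        * cis (2 * sin \<alpha> * Re (z * deriv L z) - \<alpha>)"
      unfolding E_def by (rule exp_strip_polar)
    also have "Im \<dots> < 0"
      using sneg[OF that] unfolding Im_mult_real by (simp add: mult_less_0_iff del: times_complex.sel)
    finally show False using s by simp
  qed
  have Eeq: "E z * (1 + w z * cis (-\<alpha>)) = 1 + w z * cis \<alpha>" if "z \<in> \<Delta>" for z
  proof -
    have "w z * (cis \<alpha> - E z * cis (-\<alpha>)) = E z - 1"
      using nz[OF that] by (simp add: w_def)
    thus ?thesis by (simp add: algebra_simps)
  qed
  show ?thesis
  proof (rule that)
    have "E holomorphic_on \<Delta>"
      unfolding E_def using L by (intro holomorphic_intros) auto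
    thus "w holomorphic_on \<Delta>"
      unfolding w_def using nz by (intro holomorphic_intros) auto
    show "w 0 = 0" by (simp add: w_def E_def)
    show "norm (w z) < 1" if "norm z < 1" for z
      using strip_disc_iff[OF s Eeq[of z, unfolded E_def]] sneg[of z] that by simp
    show "exp (2 * \<i> * of_real (sin \<alpha>) * (z * deriv L z)) * (1 + w z * cis (-\<alpha>)) = 1 + w z * cis \<alpha>"
      if "z \<in> \<Delta>" for z using Eeq[OF that] unfolding E_def .
  qed
qed

text \<open>Conversely, \<open>w\<close> determines \<open>q = B (w)\<close> by the logarithmic formula for \<open>B\<close>, and \<open>L\<close> is a primitive
  of \<open>q z / z\<close>. The arguments \<open>1 + w * cis (\<plusminus> \<alpha>)\<close> of the logarithms have positive real part, which
  keeps them off the branch cut and confines \<open>2 * sin \<alpha> * Re q\<close> to \<open>(-pi, pi)\<close>. On that range the sign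
  condition of \<open>strip_disc_iff\<close> no longer allows other translates of the strip.\<close>
lemma extremal_exists:
  assumes a: "0 < \<alpha>" "\<alpha> < pi"
    and w: "w holomorphic_on \<Delta>" "w 0 = 0" "\<And>z. norm z < 1 \<Longrightarrow> norm (w z) < 1"
  obtains f L where "f \<in> class_M \<alpha>" "L holomorphic_on \<Delta>" "L 0 = 0" "\<And>z. z \<in> \<Delta> \<Longrightarrow> f z = z * exp (L z)"
    "\<And>z. z \<in> \<Delta> \<Longrightarrow> exp (2 * \<i> * of_real (sin \<alpha>) * (z * deriv L z)) * (1 + w z * cis (-\<alpha>)) = 1 + w z * cis \<alpha>"
proof -
  have s: "sin \<alpha> > 0" using a by (intro sin_gt_zero)
  define c where "c = 2 * \<i> * complex_of_real (sin \<alpha>)"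
  have cnz: "c \<noteq> 0" using s by (simp add: c_def)
  define B where "B = (\<lambda>z. (Ln (1 + w z * cis \<alpha>) - Ln (1 + w z * cis (-\<alpha>))) / c)"
  have pos: "0 < Re (1 + w z * cis x)" if "z \<in> \<Delta>" for z x
  proof -
    have "\<bar>Re (w z * cis x)\<bar> < 1"
      using that w(3)[of z] abs_Re_le_cmod[of "w z * cis x"] by (simp add: norm_mult)
    thus ?thesis by simp
  qed
  have "B holomorphic_on \<Delta>"
    unfolding B_def using cnz pos w(1)
    by (intro holomorphic_intros) (auto simp: complex_nonpos_Reals_iff simp del: plus_complex.sel times_complex.sel; meson less_le_not_le)+
  moreover have "B 0 = 0" by (simp add: B_def w)
  ultimately obtain r where r: "r holomorphic_on \<Delta>" "\<And>z. norm z < 1 \<Longrightarrow> B z = z * r z"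
    using Schwarz3[of B 1] by blast
  obtain P where P: "\<And>z. z \<in> \<Delta> \<Longrightarrow> (P has_field_derivative r z) (at z within \<Delta>)"
    using holomorphic_convex_primitive'[of \<Delta> r] r(1) by auto
  define L where "L = (\<lambda>z. P z - P 0)"
  have dL: "(L has_field_derivative r z) (at z)" if "z \<in> \<Delta>" for z
    unfolding L_def using P[OF that] at_within_open[OF that]
    by (auto intro!: derivative_eq_intros)
  have L: "L holomorphic_on \<Delta>" "L 0 = 0"
    using dL unfolding holomorphic_on_open[OF open_ball] by (blast, simp add: L_def)
  have LB: "z * deriv L z = B z" if "z \<in> \<Delta>" for z
    using r(2) DERIV_imp_deriv[OF dL[OF that]] that by simp
  have eq: "exp (c * B z) * (1 + w z * cis (-\<alpha>)) = 1 + w z * cis \<alpha>" if "z \<in> \<Delta>" for z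
  proof -
    have "1 + w z * cis x \<noteq> 0" for x using pos[OF that, of x] by force
    thus ?thesis using cnz by (simp add: B_def exp_diff)
  qed
  define f where "f = (\<lambda>z. z * exp (L z))"
  have fL: "f z = z * exp (L z)" for z by (simp add: f_def)
  note lf = log_form_class_A[OF L fL]
  have "1 + (\<alpha> - pi) / (2 * sin \<alpha>) < Re (1 + B z) \<and> Re (1 + B z) < 1 + \<alpha> / (2 * sin \<alpha>)"
    if z: "z \<in> \<Delta>" for z
    unfolding strip_iff[OF s]
  proof (subst sin_neg_iff [symmetric])
    have "2 * sin \<alpha> * Re (B z) = Im (c * B z)" by (simp add: c_def)
    also have "c * B z = Ln (1 + w z * cis \<alpha>) - Ln (1 + w z * cis (-\<alpha>))"
      using cnz by (simp add: B_def)
    finally have "\<bar>2 * sin \<alpha> * Re (B z)\<bar> < pi"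
      using Re_Ln_pos_lt_imp[OF pos[OF z, of \<alpha>]] Re_Ln_pos_lt_imp[OF pos[OF z, of "-\<alpha>"]]
      by (simp only: minus_complex.sel)
    thus "-2 * pi < 2 * sin \<alpha> * Re (B z) - \<alpha>" "2 * sin \<alpha> * Re (B z) - \<alpha> < pi" using a by linarith+
    show "sin (2 * sin \<alpha> * Re (B z) - \<alpha>) < 0"
      using strip_disc_iff[OF s eq[OF z, unfolded c_def]] w(3)[of z] z by simp
  qed
  hence "f \<in> class_M \<alpha>"
    using lf(1,2) by (auto simp: class_M_def lf(3) LB simp del: plus_complex.sel)
  thus ?thesis
    using L eq LB by (intro that[of f L]) (auto simp: f_def c_def)
qed

section \<open>The sharp bound\<close>

theorem theorem2p1:
  fixes \<alpha> \<mu> \<delta>\<^sub>1 \<delta>\<^sub>2 :: real and k :: nat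
  assumes "pi / 2 \<le> \<alpha>" and "\<alpha> < pi" and "k \<ge> 1"
    and "\<delta>\<^sub>1 = (1 - real k * (1 + cos \<alpha>)) / 2"
    and "\<delta>\<^sub>2 = (1 + real k * (1 - cos \<alpha>)) / 2"
  shows "(\<forall>f \<in> class_M \<alpha>.
      (\<mu> \<le> \<delta>\<^sub>1 \<longrightarrow>
        norm (root_coeff k f (2 * k + 1) - of_real \<mu> * (root_coeff k f (k + 1))\<^sup>2)
          \<le> 1 / (2 * real k) * (1 - cos \<alpha> - (2 * \<mu> + real k - 1) / real k)) \<and>
      (\<delta>\<^sub>1 \<le> \<mu> \<and> \<mu> \<le> \<delta>\<^sub>2 \<longrightarrow>
        norm (root_coeff k f (2 * k + 1) - of_real \<mu> * (root_coeff k f (k + 1))\<^sup>2)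
          \<le> 1 / (2 * real k)) \<and>
      (\<mu> \<ge> \<delta>\<^sub>2 \<longrightarrow>
        norm (root_coeff k f (2 * k + 1) - of_real \<mu> * (root_coeff k f (k + 1))\<^sup>2)
          \<le> 1 / (2 * real k) * (cos \<alpha> + (2 * \<mu> + real k - 1) / real k - 1))) \<and>
    (\<exists>f \<in> class_M \<alpha>.
      (\<mu> \<le> \<delta>\<^sub>1 \<longrightarrow>
        norm (root_coeff k f (2 * k + 1) - of_real \<mu> * (root_coeff k f (k + 1))\<^sup>2)
          = 1 / (2 * real k) * (1 - cos \<alpha> - (2 * \<mu> + real k - 1) / real k)) \<and>
      (\<delta>\<^sub>1 \<le> \<mu> \<and> \<mu> \<le> \<delta>\<^sub>2 \<longrightarrow>
        norm (root_coeff k f (2 * k + 1) - of_real \<mu> * (root_coeff k f (k + 1))\<^sup>2)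
          = 1 / (2 * real k)) \<and>
      (\<mu> \<ge> \<delta>\<^sub>2 \<longrightarrow>
        norm (root_coeff k f (2 * k + 1) - of_real \<mu> * (root_coeff k f (k + 1))\<^sup>2)
          = 1 / (2 * real k) * (cos \<alpha> + (2 * \<mu> + real k - 1) / real k - 1)))"
proof -
  have s: "sin \<alpha> > 0" and a: "0 < \<alpha>"
    using assms(1,2) pi_gt_zero by (auto intro!: sin_gt_zero)
  have k: "real k > 0" using assms(3) by simp
  define t where "t = 1 - cos \<alpha> - (2 * \<mu> + real k - 1) / real k"
  have t': "cos \<alpha> + (2 * \<mu> + real k - 1) / real k - 1 = - t" by (simp add: t_def)
  have t1: "\<mu> \<le> \<delta>\<^sub>1 \<longleftrightarrow> 1 \<le> t" "\<delta>\<^sub>1 \<le> \<mu> \<longleftrightarrow> t \<le> 1"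
    unfolding assms(4) t_def using k by (auto simp: field_simps)
  have t2: "\<delta>\<^sub>2 \<le> \<mu> \<longleftrightarrow> t \<le> - 1" "\<mu> \<le> \<delta>\<^sub>2 \<longleftrightarrow> - 1 \<le> t"
    unfolding assms(5) t_def using k by (auto simp: field_simps)
  define \<Phi> where "\<Phi> = (\<lambda>f. norm (root_coeff k f (2 * k + 1) - of_real \<mu> * (root_coeff k f (k + 1))\<^sup>2))"
  have \<Phi>: "norm (root_coeff k f (2 * k + 1) - of_real \<mu> * (root_coeff k f (k + 1))\<^sup>2) = \<Phi> f" for f
    by (simp only: \<Phi>_def)
  have bound: "\<Phi> f \<le> max 1 \<bar>t\<bar> / (2 * real k)" if f: "f \<in> class_M \<alpha>" for f
  proof -
    obtain L where L: "L holomorphic_on \<Delta>" "L 0 = 0" "\<And>z. z \<in> \<Delta> \<Longrightarrow> f z = z * exp (L z)"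
      using f class_A_log_form[of f] by (auto simp: class_M_def)
    have "1 + (\<alpha> - pi) / (2 * sin \<alpha>) < Re (1 + z * deriv L z) \<and> Re (1 + z * deriv L z) < 1 + \<alpha> / (2 * sin \<alpha>)"
      if "z \<in> \<Delta>" for z
    proof -
      have q: "starlike_quotient f z = 1 + z * deriv L z" by (rule log_form_class_A(3)[OF L that])
      show ?thesis using f that unfolding q[symmetric] class_M_def by simp
    qed
    then obtain w where w: "w holomorphic_on \<Delta>" "w 0 = 0" "\<And>z. norm z < 1 \<Longrightarrow> norm (w z) < 1"
      and eq: "\<And>z. z \<in> \<Delta> \<Longrightarrow> exp (2 * \<i> * of_real (sin \<alpha>) * (z * deriv L z)) * (1 + w z * cis (-\<alpha>)) = 1 + w z * cis \<alpha>"
      using class_M_subordinate[OF s L(1)] by blast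
    have W: "w has_fps_expansion fps_expansion w 0"
      using w by (intro has_fps_expansion_fps_expansion[of \<Delta>]) auto
    have "\<Phi> f = norm (fps_nth (fps_expansion w 0) 2 + of_real t * (fps_nth (fps_expansion w 0) 1)\<^sup>2) / (2 * real k)"
      unfolding \<Phi>_def
      by (simp only: Fekete_Szego_functional[OF L assms(3) s W w(2) eq]
        t_def[symmetric] norm_divide norm_mult norm_numeral norm_of_nat of_nat_mult of_nat_numeral)
    thus ?thesis
      using norm_Fekete_Szego_le[OF Schwarz_second_coeff[OF w W], of t] k
      by (simp only: divide_right_mono)
  qed
  have attained: "\<exists>f \<in> class_M \<alpha>. \<Phi> f = norm (fps_nth W 2 + of_real t * (fps_nth W 1)\<^sup>2) / (2 * real k)"
    if w: "w holomorphic_on \<Delta>" "w 0 = 0" "\<And>z. norm z < 1 \<Longrightarrow> norm (w z) < 1"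
      and W: "w has_fps_expansion W" for w W
  proof -
    obtain f L where f: "f \<in> class_M \<alpha>" and L: "L holomorphic_on \<Delta>" "L 0 = 0" "\<And>z. z \<in> \<Delta> \<Longrightarrow> f z = z * exp (L z)"
      and eq: "\<And>z. z \<in> \<Delta> \<Longrightarrow> exp (2 * \<i> * of_real (sin \<alpha>) * (z * deriv L z)) * (1 + w z * cis (-\<alpha>)) = 1 + w z * cis \<alpha>"
      using extremal_exists[OF a assms(2) w] by blast
    show ?thesis
      using f unfolding \<Phi>_def
      by (intro bexI[of _ f]) (simp_all only: Fekete_Szego_functional[OF L assms(3) s W w(2) eq]
        t_def[symmetric] norm_divide norm_mult norm_numeral norm_of_nat of_nat_mult of_nat_numeral)
  qed
  have "\<exists>f \<in> class_M \<alpha>. \<Phi> f = max 1 \<bar>t\<bar> / (2 * real k)"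
  proof (cases "1 \<le> \<bar>t\<bar>")
    case True
    thus ?thesis
      using attained[of "\<lambda>z. z" fps_X] has_fps_expansion_fps_X by (auto simp: fps_X_nth)
  next
    case False
    have "(\<lambda>z::complex. z ^ 2) holomorphic_on \<Delta>" by (intro holomorphic_intros)
    from attained[OF this _ _ has_fps_expansion_fps_X_power] False show ?thesis
      by (auto simp: fps_X_power_nth norm_power abs_square_less_1)
  qed
  then obtain f where f: "f \<in> class_M \<alpha>" "\<Phi> f = max 1 \<bar>t\<bar> / (2 * real k)" by blast
  have m: "1 \<le> t \<Longrightarrow> max 1 \<bar>t\<bar> = t" "t \<le> 1 \<and> - 1 \<le> t \<Longrightarrow> max 1 \<bar>t\<bar> = 1"
    "t \<le> - 1 \<Longrightarrow> max 1 \<bar>t\<bar> = - t"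
    by auto
  show ?thesis
    unfolding t' t_def[symmetric] t1 t2 \<Phi>
  proof (intro conjI ballI bexI[OF _ f(1)] impI)
    fix g assume "g \<in> class_M \<alpha>"
    note b = bound[OF this]
    show "\<Phi> g \<le> 1 / (2 * real k) * t" if "1 \<le> t"
      using b unfolding m(1)[OF that] by simp
    show "\<Phi> g \<le> 1 / (2 * real k)" if "t \<le> 1 \<and> - 1 \<le> t"
      using b unfolding m(2)[OF that] .
    show "\<Phi> g \<le> 1 / (2 * real k) * - t" if "t \<le> - 1"
      using b unfolding m(3)[OF that] by simp
  next
    show "\<Phi> f = 1 / (2 * real k) * t" if "1 \<le> t"
      using f(2) unfolding m(1)[OF that] by simp
    show "\<Phi> f = 1 / (2 * real k)" if "t \<le> 1 \<and> - 1 \<le> t"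
      using f(2) unfolding m(2)[OF that] .
    show "\<Phi> f = 1 / (2 * real k) * - t" if "t \<le> - 1"
      using f(2) unfolding m(3)[OF that] by simp
  qed
qed

end
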